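(* Let $G^{(0)}\times\mathbb T\xrightarrow{i}\Sigma\xrightarrow{j}G$ be a twist over an étale groupoid $G$. Then $j$ admits local cross sections, in the sense that for every $g\in G$ there exist a neighbourhood $U\subseteq G$ of $g$ and a continuous map $s:U\to\Sigma$ such that $j(s(h))=h$ for all $h\in U$.
   Context: Groupoids are locally compact Hausdorff topological groupoids, with unit space $G^{(0)}$, domain map $d(g)=g^{-1}g$ and range map $r(g)=gg^{-1}$. $G$ is étale if $d$ is a local homeomorphism. A twist over $G$ is a central extension of (locally compact Hausdorff) topological groupoids $G^{(0)}\times\mathbb T\xrightarrow{i}\Sigma\xrightarrow{j}G$: $i,j$ are groupoid homomorphisms, $\Sigma^{(0)}$ is identified with $G^{(0)}$, $j(i(u,z))=u$, $i$ is a homeomorphism onto $j^{-1}(G^{(0)})\subseteq\Sigma$, $j$ is a continuous and open surjection, and $i(r(\sigma),z)\sigma=\sigma i(d(\sigma),z)$ for all $\sigma\in\Sigma$, $z\in\mathbb T$. *)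

theory Defs
  imports "HOL-Analysis.Analysis"
begin

text \<open>The arrows of a groupoid are the points of \<open>garr G\<close>; \<open>gcomp G\<close> is the set
  \<open>G\<^sup>(\<^sup>2\<^sup>)\<close> of composable pairs, outside of which the value of \<open>gmult G\<close> is irrelevant.\<close>

record 'a top_groupoid =
  gtop :: "'a topology"
  gcomp :: "('a \<times> 'a) set"
  gmult :: "'a \<Rightarrow> 'a \<Rightarrow> 'a"
  ginv :: "'a \<Rightarrow> 'a"

definition garr :: "('a, 'm) top_groupoid_scheme \<Rightarrow> 'a set" where
  "garr G = topspace (gtop G)"

definition gdom :: "('a, 'm) top_groupoid_scheme \<Rightarrow> 'a \<Rightarrow> 'a" where
  "gdom G g = gmult G (ginv G g) g"

definition gran :: "('a, 'm) top_groupoid_scheme \<Rightarrow> 'a \<Rightarrow> 'a" where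
  "gran G g = gmult G g (ginv G g)"

definition gunits :: "('a, 'm) top_groupoid_scheme \<Rightarrow> 'a set" where
  "gunits G = gdom G ` garr G"

definition gunit_top :: "('a, 'm) top_groupoid_scheme \<Rightarrow> 'a topology" where
  "gunit_top G = subtopology (gtop G) (gunits G)"

text \<open>These are the usual (Hahn--Renault) groupoid axioms. That \<open>gh\<close> is defined precisely when
  \<open>d(g) = r(h)\<close> is a consequence, see \<open>comp_iff\<close> below.\<close>

locale groupoid =
  fixes G :: "('a, 'm) top_groupoid_scheme" (structure)
  assumes comp_subset: "gcomp G \<subseteq> garr G \<times> garr G"
    and mult_closed: "(g, h) \<in> gcomp G \<Longrightarrow> gmult G g h \<in> garr G"
    and inv_closed: "g \<in> garr G \<Longrightarrow> ginv G g \<in> garr G"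
    and inv_inv: "g \<in> garr G \<Longrightarrow> ginv G (ginv G g) = g"
    and assoc_comp_left:
      "\<lbrakk>(g, h) \<in> gcomp G; (h, k) \<in> gcomp G\<rbrakk> \<Longrightarrow> (gmult G g h, k) \<in> gcomp G"
    and assoc_comp_right:
      "\<lbrakk>(g, h) \<in> gcomp G; (h, k) \<in> gcomp G\<rbrakk> \<Longrightarrow> (g, gmult G h k) \<in> gcomp G"
    and assoc:
      "\<lbrakk>(g, h) \<in> gcomp G; (h, k) \<in> gcomp G\<rbrakk>
        \<Longrightarrow> gmult G (gmult G g h) k = gmult G g (gmult G h k)"
    and inv_comp: "g \<in> garr G \<Longrightarrow> (ginv G g, g) \<in> gcomp G"
    and inv_mult_cancel:
      "(g, h) \<in> gcomp G \<Longrightarrow> gmult G (ginv G g) (gmult G g h) = h"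
    and mult_inv_cancel:
      "(g, h) \<in> gcomp G \<Longrightarrow> gmult G (gmult G g h) (ginv G h) = g"
begin

lemma comp_inv: "g \<in> garr G \<Longrightarrow> (g, ginv G g) \<in> gcomp G"
  using inv_comp[OF inv_closed] inv_inv by metis

lemma comp_iff:
  assumes "g \<in> garr G" "h \<in> garr G"
  shows "(g, h) \<in> gcomp G \<longleftrightarrow> gdom G g = gran G h"
proof
  assume gh: "(g, h) \<in> gcomp G"
  have "(gmult G (ginv G g) g, h) \<in> gcomp G"
    using assoc_comp_left[OF inv_comp gh] assms by simp
  moreover have "gmult G (gmult G (ginv G g) g) h = h"
    using assoc[OF inv_comp gh] inv_mult_cancel[OF gh] assms by simp
  ultimately show "gdom G g = gran G h"
    using mult_inv_cancel unfolding gdom_def gran_def by metis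
next
  assume eq: "gdom G g = gran G h"
  have "(g, gdom G g) \<in> gcomp G"
    unfolding gdom_def using assoc_comp_right[OF comp_inv inv_comp] assms by blast
  moreover have "(gran G h, h) \<in> gcomp G"
    unfolding gran_def using assoc_comp_left[OF comp_inv inv_comp] assms by blast
  moreover have "gmult G (gran G h) h = h"
    unfolding gran_def
    using assoc[OF comp_inv inv_comp] inv_mult_cancel[OF comp_inv[OF inv_closed]]
      inv_mult_cancel[OF inv_comp] inv_inv assms by metis
  ultimately show "(g, h) \<in> gcomp G"
    using assoc_comp_right eq by metis
qed

end

locale lch_groupoid = groupoid +
  assumes locally_compact: "locally_compact_space (gtop G)"
    and Hausdorff: "Hausdorff_space (gtop G)"
    and continuous_mult:
      "continuous_map (subtopology (prod_topology (gtop G) (gtop G)) (gcomp G)) (gtop G)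
         (\<lambda>(g, h). gmult G g h)"
    and continuous_inv: "continuous_map (gtop G) (gtop G) (ginv G)"

definition local_homeomorphism_map :: "'a topology \<Rightarrow> 'b topology \<Rightarrow> ('a \<Rightarrow> 'b) \<Rightarrow> bool" where
  "local_homeomorphism_map X Y f \<longleftrightarrow>
     (\<forall>x \<in> topspace X. \<exists>U. openin X U \<and> x \<in> U \<and> openin Y (f ` U) \<and>
        homeomorphic_map (subtopology X U) (subtopology Y (f ` U)) f)"

locale etale_groupoid = lch_groupoid +
  assumes etale: "local_homeomorphism_map (gtop G) (gunit_top G) (gdom G)"

definition groupoid_hom ::
    "('a, 'm) top_groupoid_scheme \<Rightarrow> ('b, 'n) top_groupoid_scheme \<Rightarrow> ('a \<Rightarrow> 'b) \<Rightarrow> bool" where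
  "groupoid_hom G H f \<longleftrightarrow>
     f ` garr G \<subseteq> garr H \<and>
     (\<forall>(g, h) \<in> gcomp G. (f g, f h) \<in> gcomp H \<and> f (gmult G g h) = gmult H (f g) (f h))"

text \<open>The trivial bundle of groups \<open>G\<^sup>(\<^sup>0\<^sup>) \<times> \<bbbT>\<close>.\<close>

definition circle_bundle :: "('a, 'm) top_groupoid_scheme \<Rightarrow> ('a \<times> complex) top_groupoid" where
  "circle_bundle G =
     \<lparr>gtop = prod_topology (gunit_top G) (top_of_set (sphere 0 1)),
      gcomp = {((u, z), (v, w)). u \<in> gunits G \<and> v = u \<and> z \<in> sphere 0 1 \<and> w \<in> sphere 0 1},
      gmult = (\<lambda>(u, z) (v, w). (u, z * w)),
      ginv = (\<lambda>(u, z). (u, inverse z))\<rparr>"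

text \<open>The unit spaces of \<open>\<Sigma>\<close> and \<open>G\<close> are identified along \<open>j\<close>, with inverse \<open>u \<mapsto> i(u,1)\<close>.
  In \<open>central\<close> the units \<open>r(\<sigma>)\<close> and \<open>d(\<sigma>)\<close> of \<open>\<Sigma>\<close> are therefore passed through \<open>j\<close> before
  \<open>i\<close> is applied.\<close>

locale twist =
  G: lch_groupoid G + \<Sigma>: lch_groupoid \<Sigma>
  for G :: "('a, 'm) top_groupoid_scheme" and \<Sigma> :: "('b, 'n) top_groupoid_scheme" +
  fixes i :: "'a \<times> complex \<Rightarrow> 'b" and j :: "'b \<Rightarrow> 'a"
  assumes i_hom: "groupoid_hom (circle_bundle G) \<Sigma> i"
    and j_hom: "groupoid_hom \<Sigma> G j"
    and units_identified:
      "homeomorphic_maps (gunit_top \<Sigma>) (gunit_top G) j (\<lambda>u. i (u, 1))"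
    and j_i: "\<lbrakk>u \<in> gunits G; z \<in> sphere 0 1\<rbrakk> \<Longrightarrow> j (i (u, z)) = u"
    and i_homeomorphism:
      "homeomorphic_map (gtop (circle_bundle G))
         (subtopology (gtop \<Sigma>) {\<sigma> \<in> garr \<Sigma>. j \<sigma> \<in> gunits G}) i"
    and j_continuous: "continuous_map (gtop \<Sigma>) (gtop G) j"
    and j_open: "open_map (gtop \<Sigma>) (gtop G) j"
    and j_surj: "j ` garr \<Sigma> = garr G"
    and central:
      "\<lbrakk>\<sigma> \<in> garr \<Sigma>; z \<in> sphere 0 1\<rbrakk>
        \<Longrightarrow> gmult \<Sigma> (i (j (gran \<Sigma> \<sigma>), z)) \<sigma> = gmult \<Sigma> \<sigma> (i (j (gdom \<Sigma> \<sigma>), z))"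

end

theory Submission
  imports Defs
begin

text \<open>The circle acts on \<open>\<Sigma>\<close> by \<open>z \<cdot> \<sigma> = i(r(\<sigma>), z) \<sigma>\<close>. This action is continuous and free, and
  exactness of the extension says that its orbits are the fibres of \<open>j\<close>. So \<open>j\<close> is the
  orbit map of a free action of a compact group on a locally compact Hausdorff space, and
  Gleason's argument gives local sections.

  Near \<open>\<sigma>\<^sub>0\<close> it suffices to find a continuous \<open>F : \<Sigma> \<rightarrow> \<complex>\<close> with \<open>F(z \<cdot> \<sigma>) = z F(\<sigma>)\<close> and
  \<open>F(\<sigma>\<^sub>0) \<noteq> 0\<close>: on the open set where \<open>F\<close> does not vanish, each orbit contains exactly one point
  at which \<open>F\<close> is positive. That point depends continuously on any representative of the orbit,
  hence on the orbit itself because \<open>j\<close> is open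
  (\<open>local_section_of_equivariant_function\<close>).

  To find \<open>F\<close>, observe that the orbit of \<open>\<sigma>\<^sub>0\<close> is a compact copy of the circle, so by Tietze its
  coordinate \<open>z \<cdot> \<sigma>\<^sub>0 \<mapsto> z\<close> extends to a continuous \<open>f : \<Sigma> \<rightarrow> \<complex>\<close>
  (\<open>extend_orbit_coordinate\<close>). Averaging \<open>f\<close> against the character \<open>z \<mapsto> z\<close> of the circle makes it
  equivariant, and on the orbit of \<open>\<sigma>\<^sub>0\<close>, where \<open>f\<close> was equivariant already, it only
  multiplies \<open>f\<close> by the length \<open>2\<pi>\<close> of the circle
  (\<open>equivariant_function_nonzero_at\<close>).\<close>

section \<open>Integrals depending on a parameter in a topological space\<close>

text \<open>Compactness of the interval makes the integrands for nearby parameters uniformly close, by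
  the tube lemma. As \<open>X\<close> need not be first countable, dominated convergence along sequences would
  not be enough.\<close>

lemma continuous_map_integral_parameter:
  fixes f :: "real \<times> 'b \<Rightarrow> 'e::banach"
  assumes cont: "continuous_map (prod_topology (top_of_set {a..b}) X) euclidean f"
  shows "continuous_map X euclidean (\<lambda>x. integral {a..b} (\<lambda>t. f (t, x)))"
proof (cases "a \<le> b")
  case False
  then show ?thesis by simp
next
  case ab: True
  have slice: "continuous_on {a..b} (\<lambda>t. f (t, x))" if "x \<in> topspace X" for x
  proof -
    have "continuous_map (top_of_set {a..b}) (prod_topology (top_of_set {a..b}) X) (\<lambda>t. (t, x))"
      using that by (intro continuous_map_pairedI) auto
    from continuous_map_compose[OF this cont] show ?thesis
      by (simp add: o_def)
  qed
  have near: "\<exists>V. openin X V \<and> x \<in> V \<and>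
      (\<forall>y\<in>V. dist (integral {a..b} (\<lambda>t. f (t, x))) (integral {a..b} (\<lambda>t. f (t, y))) < e)"
    if x: "x \<in> topspace X" and e: "e > 0" for x e
  proof -
    \<comment> \<open>The \<open>+ 1\<close> covers a degenerate interval and makes the final bound strict.\<close>
    define d where "d = e / (b - a + 1)"
    have d: "d > 0" "d * (b - a) < e"
    proof -
      show "d > 0" using e ab by (simp add: d_def)
      then have "d * (b - a) < d * (b - a + 1)" by simp
      also have "\<dots> = e" using ab by (simp add: d_def)
      finally show "d * (b - a) < e" .
    qed
    let ?P = "prod_topology (top_of_set {a..b}) X"
    have "continuous_map (top_of_set {a..b}) euclidean (\<lambda>t. f (t, x))"
      using slice[OF x] by simp
    from continuous_map_compose[OF continuous_map_fst this]
    have "continuous_map ?P euclidean (\<lambda>p. f (fst p, x))"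
      by (simp add: o_def)
    with cont have "continuous_map ?P euclidean (\<lambda>p. dist (f p) (f (fst p, x)))"
      by (simp add: continuous_map_atin tendsto_dist)
    then have "openin ?P {p \<in> topspace ?P. dist (f p) (f (fst p, x)) \<in> {..<d}}"
      by (rule openin_continuous_map_preimage) auto
    moreover have "compactin (top_of_set {a..b}) {a..b}"
      by (simp add: compactin_subtopology)
    moreover note x
    moreover have "{a..b} \<times> {x} \<subseteq> {p \<in> topspace ?P. dist (f p) (f (fst p, x)) \<in> {..<d}}"
      using x d(1) by auto
    ultimately have "\<exists>U V. openin (top_of_set {a..b}) U \<and> openin X V \<and> {a..b} \<subseteq> U \<and> x \<in> V \<and>
        U \<times> V \<subseteq> {p \<in> topspace ?P. dist (f p) (f (fst p, x)) \<in> {..<d}}"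
      by (rule tube_lemma_left)
    then obtain U V where UV: "openin X V" "{a..b} \<subseteq> U" "x \<in> V"
        "U \<times> V \<subseteq> {p \<in> topspace ?P. dist (f p) (f (fst p, x)) \<in> {..<d}}"
      by blast
    have "dist (integral {a..b} (\<lambda>t. f (t, x))) (integral {a..b} (\<lambda>t. f (t, y))) < e"
      if y: "y \<in> V" for y
    proof -
      have yX: "y \<in> topspace X"
        using y UV(1) openin_subset by blast
      have int: "(\<lambda>t. f (t, x)) integrable_on {a..b}" "(\<lambda>t. f (t, y)) integrable_on {a..b}"
        using slice[OF x] slice[OF yX] by (simp_all add: integrable_continuous_real)
      have "norm (integral {a..b} (\<lambda>t. f (t, x) - f (t, y))) \<le> d * (b - a)"
      proof (rule integral_bound[OF ab])
        show "continuous_on {a..b} (\<lambda>t. f (t, x) - f (t, y))"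
          using slice[OF x] slice[OF yX] by (intro continuous_intros)
        show "norm (f (t, x) - f (t, y)) \<le> d" if "t \<in> {a..b}" for t
        proof -
          have "(t, y) \<in> U \<times> V" using that y UV(2) by auto
          then have "dist (f (t, y)) (f (t, x)) < d" using UV(4) by auto
          then show ?thesis by (simp add: dist_norm norm_minus_commute)
        qed
      qed
      then show ?thesis
        using d(2) by (simp add: dist_norm Henstock_Kurzweil_Integration.integral_diff[OF int])
    qed
    with UV show ?thesis by blast
  qed
  have "openin X {x \<in> topspace X. integral {a..b} (\<lambda>t. f (t, x)) \<in> W}" if W: "open W" for W
  proof (subst openin_subopen, intro ballI)
    fix x assume x: "x \<in> {x \<in> topspace X. integral {a..b} (\<lambda>t. f (t, x)) \<in> W}"
    then obtain e where e: "e > 0" "ball (integral {a..b} (\<lambda>t. f (t, x))) e \<subseteq> W"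
      using W openE by blast
    obtain V where V: "openin X V" "x \<in> V"
      "\<forall>y\<in>V. dist (integral {a..b} (\<lambda>t. f (t, x))) (integral {a..b} (\<lambda>t. f (t, y))) < e"
      using near[of x e] x e by auto
    have "V \<subseteq> {x \<in> topspace X. integral {a..b} (\<lambda>t. f (t, x)) \<in> W}"
      using V e(2) openin_subset[OF V(1)] by auto
    with V show "\<exists>T. openin X T \<and> x \<in> T \<and> T \<subseteq> {x \<in> topspace X. integral {a..b} (\<lambda>t. f (t, x)) \<in> W}"
      by blast
  qed
  then show ?thesis
    by (simp add: continuous_map)
qed

lemma integral_periodic_shift:
  fixes p :: "real \<Rightarrow> 'e::euclidean_space"
  assumes cont: "continuous_on UNIV p" and per: "\<And>t. p (t + c) = p t"
    and s: "0 \<le> s" "s \<le> c"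
  shows "integral {0..c} (\<lambda>t. p (t + s)) = integral {0..c} p"
proof -
  have int: "p integrable_on {u..v}" for u v
    using cont by (intro integrable_continuous_real) (auto intro: continuous_on_subset)
  have "integral {0..c} (\<lambda>t. p (t + s)) = integral {s..c + s} p"
    using integral_shift[of 0 s c p] continuous_on_subset[OF cont] by (simp add: o_def)
  also have "\<dots> = integral {s..c} p + integral {c..c + s} p"
    using Henstock_Kurzweil_Integration.integral_combine[of s c "c + s" p] int s by simp
  also have "integral {c..c + s} p = integral {0..s} p"
    using integral_shift[of 0 c s p] continuous_on_subset[OF cont] by (simp add: o_def per add.commute)
  also have "integral {s..c} p + integral {0..s} p = integral {0..c} p"
    using Henstock_Kurzweil_Integration.integral_combine[of 0 s c p] int s by (simp add: add.commute)
  finally show ?thesis .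
qed

section \<open>Circle actions\<close>

locale circle_action =
  fixes X :: "'b topology" and act :: "complex \<Rightarrow> 'b \<Rightarrow> 'b"
  assumes continuous_act:
      "continuous_map (prod_topology (top_of_set (sphere 0 1)) X) X (\<lambda>(z, x). act z x)"
    and act_one: "x \<in> topspace X \<Longrightarrow> act 1 x = x"
    and act_mult: "\<lbrakk>z \<in> sphere 0 1; w \<in> sphere 0 1; x \<in> topspace X\<rbrakk>
      \<Longrightarrow> act (z * w) x = act z (act w x)"
begin

lemma act_closed: "z \<in> sphere 0 1 \<Longrightarrow> x \<in> topspace X \<Longrightarrow> act z x \<in> topspace X"
  using continuous_map_funspace[OF continuous_act] by (auto simp: Pi_iff)

text \<open>This is \<open>2\<pi>\<close> times the first Fourier coefficient of \<open>f\<close> along the orbit of \<open>x\<close>, so up to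
  that factor the projection of \<open>f\<close> to the functions on which the circle acts through the
  identity character.\<close>

definition fourier_average :: "('b \<Rightarrow> complex) \<Rightarrow> 'b \<Rightarrow> complex" where
  "fourier_average f x = integral {0..2*pi} (\<lambda>t. cis (- t) * f (act (cis t) x))"

lemma continuous_map_act_cis:
  assumes f: "continuous_map X euclidean f"
  shows "continuous_map (prod_topology (top_of_set S) X) euclidean
    (\<lambda>(t, x). cis (- t) * f (act (cis t) x))"
proof -
  let ?P = "prod_topology (top_of_set S) X"
  have cis: "continuous_map ?P euclidean (\<lambda>p. cis (c * fst p))" for c
    using continuous_map_compose[OF continuous_map_fst, of "top_of_set S" euclidean "\<lambda>t. cis (c * t)" X]
    by (simp add: o_def continuous_on_cis continuous_intros)
  have "continuous_map ?P (prod_topology (top_of_set (sphere 0 1)) X) (\<lambda>p. (cis (fst p), snd p))"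
    using cis[of 1] by (intro continuous_map_pairedI)
      (auto simp: continuous_map_in_subtopology continuous_map_snd)
  from continuous_map_compose[OF continuous_map_compose[OF this continuous_act] f]
  have "continuous_map ?P euclidean (\<lambda>p. f (act (cis (fst p)) (snd p)))"
    by (simp add: o_def)
  with cis[of "-1"] have "continuous_map ?P euclidean (\<lambda>p. cis (- fst p) * f (act (cis (fst p)) (snd p)))"
    by (simp add: continuous_map_atin tendsto_mult)
  then show ?thesis
    by (simp add: case_prod_unfold)
qed

lemma continuous_fourier_average:
  assumes "continuous_map X euclidean f"
  shows "continuous_map X euclidean (fourier_average f)"
  using continuous_map_integral_parameter[OF continuous_map_act_cis[OF assms]]
  by (simp add: fourier_average_def[abs_def])

text \<open>Acting by \<open>cis s\<close> shifts the integration variable by \<open>s\<close>; the integrand is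
  \<open>2\<pi>\<close>-periodic, so only the factor \<open>cis s\<close> from the character survives.\<close>

lemma fourier_average_equivariant:
  assumes f: "continuous_map X euclidean f" and z: "z \<in> sphere 0 1" and x: "x \<in> topspace X"
  shows "fourier_average f (act z x) = z * fourier_average f x"
proof -
  obtain s where s: "0 \<le> s" "s < 2 * pi" "z = cis s"
    using z Arg2pi_eq[of z] Arg2pi_ge_0 Arg2pi_lt_2pi
    by (metis cis_conv_exp dist_0_norm mem_sphere mult.commute mult_1 of_real_1)
  define p where "p t = cis (- t) * f (act (cis t) x)" for t
  have "continuous_map (top_of_set UNIV) (prod_topology (top_of_set UNIV) X) (\<lambda>t::real. (t, x))"
    using x by (intro continuous_map_pairedI) auto
  from continuous_map_compose[OF this continuous_map_act_cis[OF f]]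
  have cont: "continuous_on UNIV p"
    by (simp add: o_def p_def[abs_def])
  have per: "p (t + 2 * pi) = p t" for t
    using cis_mult[of t "2 * pi"] cis_mult[of "- (t + 2 * pi)" "2 * pi"] by (simp add: p_def)
  have shift: "cis (- t) * f (act (cis t) (act z x)) = z * p (t + s)" for t
  proof -
    have "act (cis t) (act z x) = act (cis (t + s)) x"
      using act_mult[of "cis t" z x] z x s by (simp add: cis_mult)
    moreover have "cis (- t) = z * cis (- (t + s))"
      by (simp add: s cis_mult)
    ultimately show ?thesis by (simp add: p_def)
  qed
  have "fourier_average f (act z x) = z * integral {0..2 * pi} (\<lambda>t. p (t + s))"
    by (simp add: fourier_average_def shift)
  also have "\<dots> = z * fourier_average f x"
    using integral_periodic_shift[OF cont per, of s] s by (simp add: fourier_average_def p_def[abs_def])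
  finally show ?thesis .
qed

text \<open>A free orbit is the injective continuous image of a compact space in a Hausdorff one, so its
  coordinate is continuous. Compact subsets of a completely regular space have the
  Tietze extension property, which is applied to the real and imaginary parts.\<close>

lemma extend_orbit_coordinate:
  assumes X: "completely_regular_space X" "Hausdorff_space X"
    and x: "x \<in> topspace X" and free: "inj_on (\<lambda>z. act z x) (sphere 0 1)"
  obtains f :: "'b \<Rightarrow> complex" where "continuous_map X euclidean f"
    "\<And>z. z \<in> sphere 0 1 \<Longrightarrow> f (act z x) = z"
proof -
  let ?T = "top_of_set (sphere 0 1 :: complex set)" and ?o = "\<lambda>z. act z x"
  define K where "K = ?o ` sphere 0 1"
  define c where "c = inv_into (sphere 0 1) ?o"
  have c: "c (act z x) = z" if "z \<in> sphere 0 1" for z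
    unfolding c_def using free that by (rule inv_into_f_f)
  have "continuous_map ?T (prod_topology ?T X) (\<lambda>z. (z, x))"
    using x by (intro continuous_map_pairedI) auto
  from continuous_map_compose[OF this continuous_act]
  have orb: "continuous_map ?T X ?o"
    by (simp add: o_def)
  have T: "compact_space ?T"
    by (simp add: compact_space_subtopology compactin_euclidean_iff)
  have K: "compactin X K"
    unfolding K_def using image_compactin[OF _ orb, of "sphere 0 1"] by (simp add: compactin_subtopology)
  have "continuous_map (subtopology X K) ?T c"
    by (rule continuous_inverse_map[OF T X(2) orb]) (use c in \<open>auto simp: K_def\<close>)
  then have cc: "continuous_map (subtopology X K) euclidean c"
    by (simp add: continuous_map_in_subtopology)
  have Re: "continuous_map (subtopology X K) euclidean (\<lambda>y. Re (c y))"
    using cc by (simp add: continuous_map_atin tendsto_Re)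
  obtain f1 where f1: "continuous_map X euclideanreal f1" "\<And>y. y \<in> K \<Longrightarrow> f1 y = Re (c y)"
    by (rule Tietze_extension_completely_regular[OF X(1) K is_interval_univ UNIV_not_empty Re subset_UNIV]) blast
  have Im: "continuous_map (subtopology X K) euclidean (\<lambda>y. Im (c y))"
    using cc by (simp add: continuous_map_atin tendsto_Im)
  obtain f2 where f2: "continuous_map X euclideanreal f2" "\<And>y. y \<in> K \<Longrightarrow> f2 y = Im (c y)"
    by (rule Tietze_extension_completely_regular[OF X(1) K is_interval_univ UNIV_not_empty Im subset_UNIV]) blast
  show thesis
  proof
    show "continuous_map X euclidean (\<lambda>y. Complex (f1 y) (f2 y))"
      using f1(1) f2(1) by (simp add: continuous_map_atin tendsto_Complex)
    show "Complex (f1 (act z x)) (f2 (act z x)) = z" if "z \<in> sphere 0 1" for z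
      using f1(2) f2(2) c that by (simp add: K_def)
  qed
qed

lemma equivariant_function_nonzero_at:
  assumes X: "completely_regular_space X" "Hausdorff_space X"
    and x: "x \<in> topspace X" and free: "inj_on (\<lambda>z. act z x) (sphere 0 1)"
  obtains F :: "'b \<Rightarrow> complex" where "continuous_map X euclidean F" "F x \<noteq> 0"
    "\<And>z y. \<lbrakk>z \<in> sphere 0 1; y \<in> topspace X\<rbrakk> \<Longrightarrow> F (act z y) = z * F y"
proof -
  obtain f :: "'b \<Rightarrow> complex" where f: "continuous_map X euclidean f"
    "\<And>z. z \<in> sphere 0 1 \<Longrightarrow> f (act z x) = z"
    using extend_orbit_coordinate[OF assms] by blast
  have "fourier_average f x = of_real (2 * pi)"
    by (simp add: fourier_average_def f(2) cis_mult scaleR_conv_of_real)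
  then have "fourier_average f x \<noteq> 0" by simp
  then show thesis
    using that[of "fourier_average f"] continuous_fourier_average f(1) fourier_average_equivariant
    by blast
qed

text \<open>\<open>N\<close> moves a point along its orbit to the place where \<open>F\<close> is positive. This makes \<open>N\<close>
  constant on orbits, so it factors through the quotient map \<open>q\<close>, and the factor is the section.\<close>

lemma local_section_of_equivariant_function:
  assumes q: "continuous_map X Y q" "open_map X Y q"
    and fibres: "\<And>x y. \<lbrakk>x \<in> topspace X; y \<in> topspace X\<rbrakk>
      \<Longrightarrow> q x = q y \<longleftrightarrow> (\<exists>z \<in> sphere 0 1. y = act z x)"
    and F: "continuous_map X euclidean F"
    and equiv: "\<And>z x. \<lbrakk>z \<in> sphere 0 1; x \<in> topspace X\<rbrakk> \<Longrightarrow> F (act z x) = z * F x"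
  obtains s where
    "continuous_map (subtopology Y (q ` {x \<in> topspace X. F x \<noteq> 0})) X s"
    "\<And>y. y \<in> q ` {x \<in> topspace X. F x \<noteq> 0} \<Longrightarrow> q (s y) = y"
proof -
  define V where "V = {x \<in> topspace X. F x \<noteq> 0}"
  define N where "N x = act (cnj (sgn (F x))) x" for x
  have phase: "cnj (sgn (F x)) \<in> sphere 0 1" if "x \<in> V" for x
    using that by (simp add: V_def norm_sgn)
  have V: "openin X V"
    using openin_continuous_map_preimage[OF F, of "- {0}"] by (simp add: V_def open_Compl)
  have VX: "V \<subseteq> topspace X" by (auto simp: V_def)
  have qN: "q (N x) = q x" if "x \<in> V" for x
  proof -
    have "x \<in> topspace X" using that VX by blast
    then show ?thesis
      using fibres[of x "N x"] phase[OF that] act_closed[OF phase[OF that]] unfolding N_def by metis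
  qed
  have N_inv: "N x = N y" if xV: "x \<in> V" and yV: "y \<in> V" and xy: "q x = q y" for x y
  proof -
    have X: "x \<in> topspace X" "y \<in> topspace X"
      using xV yV VX by blast+
    then obtain z where z: "z \<in> sphere 0 1" "y = act z x"
      using fibres[OF X] xy by blast
    have zz: "cnj z * z = 1"
      using z(1) by (simp add: complex_norm_square[symmetric] mult.commute)
    have "sgn (F y) = z * sgn (F x)"
      using equiv[OF z(1) X(1)] z by (simp add: sgn_mult sgn_eq norm_mult)
    then have "N y = act (cnj (sgn (F y)) * z) x"
      using act_mult[OF phase[OF yV] z(1) X(1)] z(2) by (simp add: N_def)
    also have "cnj (sgn (F y)) * z = cnj (sgn (F x))"
      using \<open>sgn (F y) = z * sgn (F x)\<close> zz by (simp add: algebra_simps)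
    finally show ?thesis unfolding N_def ..
  qed
  have N_cont: "continuous_map (subtopology X V) X N"
  proof -
    have "continuous_map (subtopology X V) euclidean F"
      using F by (rule continuous_map_from_subtopology)
    then have "continuous_map (subtopology X V) euclidean (\<lambda>x. cnj (sgn (F x)))"
      by (auto simp: continuous_map_atin V_def intro!: tendsto_cnj tendsto_sgn)
    then have "continuous_map (subtopology X V) (top_of_set (sphere 0 1)) (\<lambda>x. cnj (sgn (F x)))"
      using phase by (auto simp: continuous_map_in_subtopology)
    then have "continuous_map (subtopology X V) (prod_topology (top_of_set (sphere 0 1)) X)
        (\<lambda>x. (cnj (sgn (F x)), x))"
      by (intro continuous_map_pairedI) (auto intro: continuous_map_from_subtopology)
    from continuous_map_compose[OF this continuous_act] show ?thesis
      by (simp add: o_def N_def[abs_def])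
  qed
  define s where "s = N \<circ> inv_into V q"
  have sq: "s (q x) = N x" if "x \<in> V" for x
    using N_inv[of "inv_into V q (q x)" x] that
    by (simp add: s_def inv_into_into f_inv_into_f)
  have "quotient_map (subtopology X V) (subtopology Y (q ` V)) q"
  proof (rule continuous_open_imp_quotient_map)
    show "continuous_map (subtopology X V) (subtopology Y (q ` V)) q"
      using q(1) by (auto simp: continuous_map_in_subtopology intro: continuous_map_from_subtopology)
    show "open_map (subtopology X V) (subtopology Y (q ` V)) q"
      using q(2) V by (auto simp: open_map_def openin_open_subtopology)
    show "q ` topspace (subtopology X V) = topspace (subtopology Y (q ` V))"
      using VX continuous_map_image_subset_topspace[OF q(1)] by auto
  qed
  moreover have "continuous_map (subtopology X V) X (s \<circ> q)"
    using N_cont by (rule continuous_map_eq) (use sq in auto)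
  ultimately have "continuous_map (subtopology Y (q ` V)) X s"
    by (rule continuous_compose_quotient_map)
  moreover have "q (s y) = y" if "y \<in> q ` V" for y
    using that sq qN by auto
  ultimately show thesis
    using that by (simp add: V_def)
qed

text \<open>The circle case of Gleason's theorem on actions of compact Lie groups. Freeness is asked for
  at one orbit: an equivariant function that is nonzero there witnesses it for the nearby orbits.\<close>

theorem local_section_at_free_orbit:
  assumes X: "completely_regular_space X" "Hausdorff_space X"
    and q: "continuous_map X Y q" "open_map X Y q"
    and fibres: "\<And>x y. \<lbrakk>x \<in> topspace X; y \<in> topspace X\<rbrakk>
      \<Longrightarrow> q x = q y \<longleftrightarrow> (\<exists>z \<in> sphere 0 1. y = act z x)"
    and x: "x \<in> topspace X" and free: "inj_on (\<lambda>z. act z x) (sphere 0 1)"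
  obtains U s where "openin Y U" "q x \<in> U" "continuous_map (subtopology Y U) X s"
    "\<And>y. y \<in> U \<Longrightarrow> q (s y) = y"
proof -
  obtain F :: "'b \<Rightarrow> complex" where F: "continuous_map X euclidean F" "F x \<noteq> 0"
    "\<And>z y. \<lbrakk>z \<in> sphere 0 1; y \<in> topspace X\<rbrakk> \<Longrightarrow> F (act z y) = z * F y"
    using equivariant_function_nonzero_at[OF X x free] by blast
  let ?V = "{x \<in> topspace X. F x \<noteq> 0}"
  have "openin X ?V"
    using openin_continuous_map_preimage[OF F(1), of "- {0}"] by (simp add: open_Compl)
  then have "openin Y (q ` ?V)"
    using q(2) by (simp add: open_map_def)
  moreover have "q x \<in> q ` ?V"
    using x F(2) by blast
  moreover obtain s where "continuous_map (subtopology Y (q ` ?V)) X s"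
    "\<And>y. y \<in> q ` ?V \<Longrightarrow> q (s y) = y"
    using local_section_of_equivariant_function[OF q fibres F(1,3)] by blast
  ultimately show thesis
    using that by blast
qed

end

section \<open>The circle action on a twist\<close>

context groupoid
begin

lemma gran_closed: "g \<in> garr G \<Longrightarrow> gran G g \<in> garr G"
  unfolding gran_def using comp_inv mult_closed by blast

lemma gran_gunits: "g \<in> garr G \<Longrightarrow> gran G g \<in> gunits G"
  unfolding gunits_def gran_def using inv_closed inv_inv gdom_def by (metis imageI)

lemma gran_left_unit: "g \<in> garr G \<Longrightarrow> (gran G g, g) \<in> gcomp G \<and> gmult G (gran G g) g = g"
  unfolding gran_def
  using assoc_comp_left[OF comp_inv inv_comp] assoc[OF comp_inv inv_comp]
    inv_mult_cancel[OF comp_inv[OF inv_closed]] inv_mult_cancel[OF inv_comp] inv_inv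
  by metis

end

context twist
begin

lemma j_closed: "\<sigma> \<in> garr \<Sigma> \<Longrightarrow> j \<sigma> \<in> garr G"
  using j_hom by (auto simp: groupoid_hom_def)

lemma j_mult: "(\<sigma>, \<tau>) \<in> gcomp \<Sigma> \<Longrightarrow> (j \<sigma>, j \<tau>) \<in> gcomp G \<and> j (gmult \<Sigma> \<sigma> \<tau>) = gmult G (j \<sigma>) (j \<tau>)"
  using j_hom by (auto simp: groupoid_hom_def)

text \<open>A homomorphism is only required to respect products; that it respects inverses follows by
  cancellation from \<open>\<sigma> (\<sigma>\<^sup>-\<^sup>1 \<sigma>) = \<sigma>\<close>.\<close>

lemma j_inv: "\<sigma> \<in> garr \<Sigma> \<Longrightarrow> j (ginv \<Sigma> \<sigma>) = ginv G (j \<sigma>)"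
proof -
  assume s: "\<sigma> \<in> garr \<Sigma>"
  note c = \<Sigma>.inv_comp[OF s] \<Sigma>.comp_inv[OF s]
  have "j \<sigma> = j (gmult \<Sigma> \<sigma> (gmult \<Sigma> (ginv \<Sigma> \<sigma>) \<sigma>))"
    using \<Sigma>.gran_left_unit[OF s] \<Sigma>.assoc[OF c(2) c(1)] by (simp add: gran_def)
  also have "\<dots> = gmult G (j \<sigma>) (gmult G (j (ginv \<Sigma> \<sigma>)) (j \<sigma>))"
    using j_mult c \<Sigma>.assoc_comp_right[OF c(2) c(1)] by metis
  finally have e: "j \<sigma> = gmult G (j \<sigma>) (gmult G (j (ginv \<Sigma> \<sigma>)) (j \<sigma>))" .
  have jc: "(j (ginv \<Sigma> \<sigma>), j \<sigma>) \<in> gcomp G" "(j \<sigma>, j (ginv \<Sigma> \<sigma>)) \<in> gcomp G"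
    using j_mult c by blast+
  have "gmult G (ginv G (j \<sigma>)) (j \<sigma>) = gmult G (j (ginv \<Sigma> \<sigma>)) (j \<sigma>)"
    using G.inv_mult_cancel[OF G.assoc_comp_right[OF jc(2) jc(1)]] e by simp
  then show ?thesis
    using G.mult_inv_cancel[OF jc(1)] G.mult_inv_cancel[OF G.inv_comp[OF j_closed[OF s]]] by metis
qed

lemma j_gran: "\<sigma> \<in> garr \<Sigma> \<Longrightarrow> j (gran \<Sigma> \<sigma>) = gran G (j \<sigma>)"
  using j_mult[OF \<Sigma>.comp_inv] j_inv by (simp add: gran_def)

lemma i_mult: "\<lbrakk>u \<in> gunits G; z \<in> sphere 0 1; w \<in> sphere 0 1\<rbrakk>
  \<Longrightarrow> (i (u, z), i (u, w)) \<in> gcomp \<Sigma> \<and> gmult \<Sigma> (i (u, z)) (i (u, w)) = i (u, z * w)"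
  using i_hom by (force simp: groupoid_hom_def circle_bundle_def)

lemma i_gran:
  assumes s: "\<sigma> \<in> garr \<Sigma>"
  shows "i (gran G (j \<sigma>), 1) = gran \<Sigma> \<sigma>"
proof -
  have "gran \<Sigma> \<sigma> \<in> topspace (gunit_top \<Sigma>)"
    using s \<Sigma>.gran_gunits \<Sigma>.gran_closed by (auto simp: gunit_top_def garr_def)
  then have "i (j (gran \<Sigma> \<sigma>), 1) = gran \<Sigma> \<sigma>"
    using units_identified by (auto simp: homeomorphic_maps_def)
  then show ?thesis using s j_gran by simp
qed

text \<open>The range is taken in \<open>G\<close>: there it is a unit to which \<open>i\<close> applies directly, and it
  is visibly constant on the fibres of \<open>j\<close>.\<close>

definition circ :: "complex \<Rightarrow> 'b \<Rightarrow> 'b" where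
  "circ z \<sigma> = gmult \<Sigma> (i (gran G (j \<sigma>), z)) \<sigma>"

lemma circ_comp:
  assumes "\<sigma> \<in> garr \<Sigma>" "z \<in> sphere 0 1"
  shows "(i (gran G (j \<sigma>), z), \<sigma>) \<in> gcomp \<Sigma>"
proof -
  let ?u = "gran G (j \<sigma>)"
  have u: "?u \<in> gunits G"
    using assms G.gran_gunits j_closed by blast
  have "(i (?u, z), i (?u, 1)) \<in> gcomp \<Sigma>" "gmult \<Sigma> (i (?u, z)) (i (?u, 1)) = i (?u, z)"
    using i_mult[OF u assms(2), of 1] by auto
  then show ?thesis
    using \<Sigma>.assoc_comp_left \<Sigma>.gran_left_unit[OF assms(1)] i_gran[OF assms(1)] by metis
qed

lemma j_circ:
  assumes "\<sigma> \<in> garr \<Sigma>" "z \<in> sphere 0 1"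
  shows "j (circ z \<sigma>) = j \<sigma>"
  using j_mult[OF circ_comp[OF assms]] assms j_i G.gran_gunits G.gran_left_unit j_closed
  by (simp add: circ_def)

lemma continuous_circ:
  "continuous_map (prod_topology (top_of_set (sphere 0 1)) (gtop \<Sigma>)) (gtop \<Sigma>) (\<lambda>(z, \<sigma>). circ z \<sigma>)"
proof -
  let ?P = "prod_topology (top_of_set (sphere 0 1 :: complex set)) (gtop \<Sigma>)"
  have "continuous_map (gtop G) (subtopology (prod_topology (gtop G) (gtop G)) (gcomp G))
      (\<lambda>g. (g, ginv G g))"
    using G.continuous_inv G.comp_inv
    by (auto simp: continuous_map_in_subtopology garr_def intro!: continuous_map_pairedI)
  from continuous_map_compose[OF this G.continuous_mult]
  have "continuous_map (gtop G) (gtop G) (gran G)"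
    by (simp add: o_def gran_def[abs_def])
  then have ran: "continuous_map (gtop G) (gunit_top G) (gran G)"
    using G.gran_gunits by (auto simp: gunit_top_def continuous_map_in_subtopology garr_def)
  have "continuous_map ?P (gunit_top G) (gran G \<circ> (j \<circ> snd))"
    by (intro continuous_map_compose[OF _ ran] continuous_map_compose[OF continuous_map_snd j_continuous])
  then have "continuous_map ?P (gtop (circle_bundle G)) (\<lambda>p. (gran G (j (snd p)), fst p))"
    by (auto simp: circle_bundle_def o_def continuous_map_fst intro!: continuous_map_pairedI)
  moreover have "continuous_map (gtop (circle_bundle G)) (gtop \<Sigma>) i"
    using homeomorphic_imp_continuous_map[OF i_homeomorphism] by (simp add: continuous_map_in_subtopology)
  ultimately have "continuous_map ?P (gtop \<Sigma>) (i \<circ> (\<lambda>p. (gran G (j (snd p)), fst p)))"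
    by (rule continuous_map_compose)
  then have "continuous_map ?P (subtopology (prod_topology (gtop \<Sigma>) (gtop \<Sigma>)) (gcomp \<Sigma>))
      (\<lambda>p. (i (gran G (j (snd p)), fst p), snd p))"
    using circ_comp
    by (auto simp: continuous_map_in_subtopology garr_def o_def continuous_map_snd intro!: continuous_map_pairedI)
  from continuous_map_compose[OF this \<Sigma>.continuous_mult]
  show ?thesis by (simp add: o_def circ_def case_prod_unfold)
qed

lemma circle_action_circ: "circle_action (gtop \<Sigma>) circ"
proof
  show "continuous_map (prod_topology (top_of_set (sphere 0 1)) (gtop \<Sigma>)) (gtop \<Sigma>) (\<lambda>(z, \<sigma>). circ z \<sigma>)"
    by (rule continuous_circ)
next
  fix \<sigma> assume "\<sigma> \<in> topspace (gtop \<Sigma>)"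
  then have s: "\<sigma> \<in> garr \<Sigma>" by (simp add: garr_def)
  then show "circ 1 \<sigma> = \<sigma>"
    using i_gran \<Sigma>.gran_left_unit by (simp add: circ_def)
next
  fix z w :: complex and \<sigma>
  assume zw: "z \<in> sphere 0 1" "w \<in> sphere 0 1" and "\<sigma> \<in> topspace (gtop \<Sigma>)"
  then have s: "\<sigma> \<in> garr \<Sigma>" by (simp add: garr_def)
  let ?u = "gran G (j \<sigma>)"
  have u: "?u \<in> gunits G"
    using s G.gran_gunits j_closed by blast
  have "circ z (circ w \<sigma>) = gmult \<Sigma> (i (?u, z)) (gmult \<Sigma> (i (?u, w)) \<sigma>)"
    using j_circ[OF s zw(2)] unfolding circ_def by simp
  also have "\<dots> = gmult \<Sigma> (gmult \<Sigma> (i (?u, z)) (i (?u, w))) \<sigma>"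
    using \<Sigma>.assoc i_mult[OF u zw] circ_comp[OF s zw(2)] by metis
  also have "\<dots> = circ (z * w) \<sigma>"
    using i_mult[OF u zw] by (simp add: circ_def)
  finally show "circ (z * w) \<sigma> = circ z (circ w \<sigma>)" ..
qed

lemma circ_free:
  assumes s: "\<sigma> \<in> garr \<Sigma>"
  shows "inj_on (\<lambda>z. circ z \<sigma>) (sphere 0 1)"
proof (rule inj_onI)
  fix z w :: complex
  assume zw: "z \<in> sphere 0 1" "w \<in> sphere 0 1" and eq: "circ z \<sigma> = circ w \<sigma>"
  let ?u = "gran G (j \<sigma>)"
  have u: "?u \<in> gunits G" "?u \<in> garr G"
    using s G.gran_gunits G.gran_closed j_closed by blast+
  have "i (?u, z) = i (?u, w)"
    using \<Sigma>.mult_inv_cancel circ_comp[OF s] zw eq unfolding circ_def by metis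
  moreover have "inj_on i (topspace (gtop (circle_bundle G)))"
    using i_homeomorphism by (simp add: homeomorphic_map_def quotient_map_def homeomorphic_eq_everything_map)
  ultimately show "z = w"
    using zw u by (auto simp: inj_on_def circle_bundle_def gunit_top_def garr_def)
qed

text \<open>If \<open>j(\<sigma>) = j(\<tau>)\<close> then \<open>\<tau> \<sigma>\<^sup>-\<^sup>1\<close> is defined and lies over a unit, so by exactness it is
  some \<open>i(u, z)\<close>, and \<open>u\<close> must be the range of \<open>j(\<sigma>)\<close>.\<close>

lemma j_fibre_iff:
  assumes s: "\<sigma> \<in> garr \<Sigma>" and t: "\<tau> \<in> garr \<Sigma>"
  shows "j \<sigma> = j \<tau> \<longleftrightarrow> (\<exists>z \<in> sphere 0 1. \<tau> = circ z \<sigma>)"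
proof
  assume "\<exists>z \<in> sphere 0 1. \<tau> = circ z \<sigma>"
  then show "j \<sigma> = j \<tau>" using j_circ[OF s] by auto
next
  assume eq: "j \<sigma> = j \<tau>"
  let ?\<rho> = "gmult \<Sigma> \<tau> (ginv \<Sigma> \<sigma>)"
  have si: "ginv \<Sigma> \<sigma> \<in> garr \<Sigma>" using s by (rule \<Sigma>.inv_closed)
  have inv: "j (ginv \<Sigma> \<sigma>) = j (ginv \<Sigma> \<tau>)" using eq s t j_inv by simp
  \<comment> \<open>Units of \<open>\<Sigma>\<close> are determined by their images under \<open>j\<close>, so composability can be tested in \<open>G\<close>.\<close>
  have "gran \<Sigma> (ginv \<Sigma> \<sigma>) = gran \<Sigma> (ginv \<Sigma> \<tau>)"
    using i_gran[OF si] i_gran[OF \<Sigma>.inv_closed[OF t]] inv by simp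
  then have comp: "(\<tau>, ginv \<Sigma> \<sigma>) \<in> gcomp \<Sigma>"
    using \<Sigma>.comp_iff[OF t] \<Sigma>.comp_inv[OF t] si \<Sigma>.inv_closed[OF t] by metis
  have j\<rho>: "j ?\<rho> = gran G (j \<sigma>)"
    using j_mult[OF comp] j_inv[OF s] eq by (simp add: gran_def)
  have u: "gran G (j \<sigma>) \<in> gunits G"
    using s G.gran_gunits j_closed by blast
  have "?\<rho> \<in> topspace (subtopology (gtop \<Sigma>) {\<sigma> \<in> garr \<Sigma>. j \<sigma> \<in> gunits G})"
    using \<Sigma>.mult_closed[OF comp] j\<rho> u by (simp add: garr_def)
  then have "?\<rho> \<in> i ` topspace (gtop (circle_bundle G))"
    using homeomorphic_imp_surjective_map[OF i_homeomorphism] by simp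
  then obtain v z where vz: "v \<in> gunits G" "z \<in> sphere 0 1" "?\<rho> = i (v, z)"
    by (auto simp: circle_bundle_def gunit_top_def)
  have "v = gran G (j \<sigma>)"
    using j_i[OF vz(1,2)] vz(3) j\<rho> by simp
  then have "circ z \<sigma> = gmult \<Sigma> ?\<rho> \<sigma>"
    using vz by (simp add: circ_def)
  also have "\<dots> = \<tau>"
    using \<Sigma>.mult_inv_cancel[OF comp] \<Sigma>.inv_inv[OF s] by simp
  finally show "\<exists>z \<in> sphere 0 1. \<tau> = circ z \<sigma>"
    using vz by blast
qed

end

theorem proposition3p4:
  fixes G :: "('a, 'm) top_groupoid_scheme"
    and \<Sigma> :: "('b, 'n) top_groupoid_scheme"
    and i :: "'a \<times> complex \<Rightarrow> 'b" and j :: "'b \<Rightarrow> 'a"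
  assumes "etale_groupoid G"
    and "twist G \<Sigma> i j"
  shows "\<forall>g \<in> garr G. \<exists>U s. openin (gtop G) U \<and> g \<in> U \<and>
           continuous_map (subtopology (gtop G) U) (gtop \<Sigma>) s \<and>
           (\<forall>h \<in> U. j (s h) = h)"
proof
  fix g assume "g \<in> garr G"
  interpret twist G \<Sigma> i j by (rule assms(2))
  interpret circle_action "gtop \<Sigma>" circ by (rule circle_action_circ)
  have "g \<in> j ` garr \<Sigma>"
    using \<open>g \<in> garr G\<close> by (simp add: j_surj)
  then obtain \<sigma> where \<sigma>: "\<sigma> \<in> garr \<Sigma>" "j \<sigma> = g"
    by (auto elim: imageE)
  have creg: "completely_regular_space (gtop \<Sigma>)"
    using locally_compact_regular_imp_completely_regular_space[OF \<Sigma>.locally_compact] \<Sigma>.Hausdorff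
    by simp
  have fibres: "j \<tau> = j \<rho> \<longleftrightarrow> (\<exists>z \<in> sphere 0 1. \<rho> = circ z \<tau>)"
    if "\<tau> \<in> topspace (gtop \<Sigma>)" "\<rho> \<in> topspace (gtop \<Sigma>)" for \<tau> \<rho>
    using j_fibre_iff[unfolded garr_def, OF that] .
  obtain U s where "openin (gtop G) U" "j \<sigma> \<in> U"
    "continuous_map (subtopology (gtop G) U) (gtop \<Sigma>) s" "\<And>h. h \<in> U \<Longrightarrow> j (s h) = h"
    using local_section_at_free_orbit[OF creg \<Sigma>.Hausdorff j_continuous j_open fibres
        \<sigma>(1)[unfolded garr_def] circ_free[OF \<sigma>(1)]]
    by blast
  then show "\<exists>U s. openin (gtop G) U \<and> g \<in> U \<and>
      continuous_map (subtopology (gtop G) U) (gtop \<Sigma>) s \<and> (\<forall>h \<in> U. j (s h) = h)"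
    using \<sigma>(2) by blast
qed

end
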